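(* Let $d,n\ge 1$, $0<\gamma\le 1$, and let $(X^{(t)},R^{(t)},X^{(t+1)})_{t=1,\dots,n}$ be a dataset generated by a linear system with linear rewards, with $X^{(t)}\in\mathbb R^d$ and $R^{(t)}\in\mathbb R$. Assume that the matrices $\sum_{t=1}^n X^{(t)}(X^{(t)})^\top$ and $\sum_{t=1}^n X^{(t)}(X^{(t)}-\gamma X^{(t+1)})^\top$ are invertible, so that the estimators below are well defined. Then the LSTD estimator coincides with the model-based estimator with no restriction on the dynamics: $$\hat\beta_{\rm LSTD}=\hat\beta_{\rm Model\,Based}.$$
   Context: Linear system with linear rewards: $X^{(t+1)}=AX^{(t)}+\epsilon^{(t)}$ and $R^{(t)}=\theta^\top X^{(t)}+\eta^{(t)}$, where $A\in\mathbb R^{d\times d}$ is stable (spectral radius $<1$), $\theta\in\mathbb R^d$, and $(\epsilon^{(t)})$, $(\eta^{(t)})$ are independent i.i.d. sequences with $\epsilon^{(t)}\sim\mathcal N(0,\sigma^2I_d)$, $\eta^{(t)}\sim\mathcal N(0,\sigma^2)$. The LSTD estimator is $$\hat\beta_{\rm LSTD}=\Big(\sum_{t=1}^nX^{(t)}(X^{(t)}-\gamma X^{(t+1)})^\top\Big)^{-1}\sum_{t=1}^nR^{(t)}X^{(t)}.$$ The (unrestricted) model-based estimator is $$\hat\beta_{\rm Model\,Based}=(I_d-\gamma\hat A^\top)^{-1}\hat\theta,\quad \hat A=\arg\min_{A\in\mathbb R^{d\times d}}\sum_{t=1}^n\|X^{(t+1)}-AX^{(t)}\|^2,\quad \hat\theta=\arg\min_{\theta\in\mathbb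 R^d}\sum_{t=1}^n(R^{(t)}-\theta^\top X^{(t)})^2.$$ *)

theory Defs
  imports "HOL-Probability.Probability"
begin

definition spectral_radius :: "real ^ 'd ^ 'd \<Rightarrow> real" where
  "spectral_radius A =
     Max {cmod z | z. \<exists>v::complex ^ 'd. v \<noteq> 0 \<and> (\<chi> i j. complex_of_real (A $ i $ j)) *v v = z *s v}"

(* N(0, sigma^2 I) on a Euclidean space (real ^ 'd or real). As normal_density 0 0 is
   constantly 0, the degenerate case sigma = 0 is given separately, as the Dirac measure at 0. *)
definition isotropic_normal :: "real \<Rightarrow> 'a::euclidean_space measure" where
  "isotropic_normal \<sigma> =
     (if \<sigma> = 0 then return borel 0
      else density lborel (\<lambda>x. ennreal (\<Prod>b\<in>Basis. normal_density 0 \<sigma> (x \<bullet> b))))"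

(* The two noise sequences live in different spaces, so their mutual independence is stated
   for the sigma-algebras they generate. Nothing is assumed about the law of the initial state X 1. *)
locale linear_reward_system = prob_space M for M :: "'w measure" +
  fixes A :: "real ^ 'd ^ 'd"
    and \<theta> :: "real ^ 'd"
    and \<sigma> :: real
    and \<epsilon> :: "nat \<Rightarrow> 'w \<Rightarrow> real ^ 'd"
    and \<eta> :: "nat \<Rightarrow> 'w \<Rightarrow> real"
    and X :: "nat \<Rightarrow> 'w \<Rightarrow> real ^ 'd"
    and R :: "nat \<Rightarrow> 'w \<Rightarrow> real"
  assumes sigma_nonneg: "0 \<le> \<sigma>"
    and stable: "spectral_radius A < 1"
    and initial_rv: "random_variable borel (X 1)"
    and indep_eps: "indep_vars (\<lambda>_. borel) \<epsilon> {1..}"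
    and distr_eps: "\<And>t. 1 \<le> t \<Longrightarrow> distr M borel (\<epsilon> t) = isotropic_normal \<sigma>"
    and indep_eta: "indep_vars (\<lambda>_. borel) \<eta> {1..}"
    and distr_eta: "\<And>t. 1 \<le> t \<Longrightarrow> distr M borel (\<eta> t) = isotropic_normal \<sigma>"
    and indep_eps_eta: "indep_set
      (sets (vimage_algebra (space M) (\<lambda>\<omega>. \<lambda>t\<in>{1..}. \<epsilon> t \<omega>) (\<Pi>\<^sub>M t\<in>{1..}. borel)))
      (sets (vimage_algebra (space M) (\<lambda>\<omega>. \<lambda>t\<in>{1..}. \<eta> t \<omega>) (\<Pi>\<^sub>M t\<in>{1..}. borel)))"
    and dynamics: "\<And>t \<omega>. 1 \<le> t \<Longrightarrow> \<omega> \<in> space M \<Longrightarrow> X (Suc t) \<omega> = A *v X t \<omega> + \<epsilon> t \<omega>"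
    and rewards: "\<And>t \<omega>. 1 \<le> t \<Longrightarrow> \<omega> \<in> space M \<Longrightarrow> R t \<omega> = \<theta> \<bullet> X t \<omega> + \<eta> t \<omega>"

definition outer_prod :: "real ^ 'd \<Rightarrow> real ^ 'd \<Rightarrow> real ^ 'd ^ 'd" where
  "outer_prod u v = (\<chi> i j. u $ i * v $ j)"

(* The estimators act on a realised dataset (x t, r t, x (t + 1)) for t = 1, ..., n. *)

definition gram_matrix :: "nat \<Rightarrow> (nat \<Rightarrow> real ^ 'd) \<Rightarrow> real ^ 'd ^ 'd" where
  "gram_matrix n x = (\<Sum>t=1..n. outer_prod (x t) (x t))"

definition lstd_matrix :: "real \<Rightarrow> nat \<Rightarrow> (nat \<Rightarrow> real ^ 'd) \<Rightarrow> real ^ 'd ^ 'd" where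
  "lstd_matrix \<gamma> n x = (\<Sum>t=1..n. outer_prod (x t) (x t - \<gamma> *\<^sub>R x (Suc t)))"

definition beta_LSTD :: "real \<Rightarrow> nat \<Rightarrow> (nat \<Rightarrow> real ^ 'd) \<Rightarrow> (nat \<Rightarrow> real) \<Rightarrow> real ^ 'd" where
  "beta_LSTD \<gamma> n x r = matrix_inv (lstd_matrix \<gamma> n x) *v (\<Sum>t=1..n. r t *\<^sub>R x t)"

definition A_hat :: "nat \<Rightarrow> (nat \<Rightarrow> real ^ 'd) \<Rightarrow> real ^ 'd ^ 'd" where
  "A_hat n x = (ARG_MIN (\<lambda>B. \<Sum>t=1..n. (norm (x (Suc t) - B *v x t))\<^sup>2) B. True)"

definition theta_hat :: "nat \<Rightarrow> (nat \<Rightarrow> real ^ 'd) \<Rightarrow> (nat \<Rightarrow> real) \<Rightarrow> real ^ 'd" where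
  "theta_hat n x r = (ARG_MIN (\<lambda>b. \<Sum>t=1..n. (r t - b \<bullet> x t)\<^sup>2) b. True)"

definition beta_model_based :: "real \<Rightarrow> nat \<Rightarrow> (nat \<Rightarrow> real ^ 'd) \<Rightarrow> (nat \<Rightarrow> real) \<Rightarrow> real ^ 'd" where
  "beta_model_based \<gamma> n x r = matrix_inv (mat 1 - \<gamma> *\<^sub>R transpose (A_hat n x)) *v theta_hat n x r"

end

theory Submission
  imports Defs
begin

text \<open>
  Write \<open>y t\<close> for \<open>x (t + 1)\<close>, \<open>G\<close> for the Gram matrix and \<open>L\<close> for the LSTD matrix. The normal
  equations of the two least squares problems are \<open>G \<theta>' = (\<Sum>t. r t x t)\<close> and
  \<open>G A'\<^sup>T = (\<Sum>t. x t (y t)\<^sup>T)\<close>; as \<open>G\<close> is invertible, they determine the minimisers \<open>\<theta>'\<close> and \<open>A'\<close>.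
  The second one turns the LSTD matrix into \<open>L = G (1 - \<gamma> A'\<^sup>T)\<close>, so \<open>1 - \<gamma> A'\<^sup>T\<close> is invertible and
  \<open>L (1 - \<gamma> A'\<^sup>T)\<^sup>-\<^sup>1 \<theta>' = G \<theta>' = (\<Sum>t. r t x t)\<close>.
\<close>

text \<open>Expand the square around \<open>b0\<close>: by \<open>orth\<close> the residual at
  \<open>b0\<close> is orthogonal to every direction \<open>P t d\<close>, so the cross terms sum to
  zero. Abstract parameters \<open>b\<close> and linear maps \<open>P t\<close> let one argument
  serve both regressions, over vectors and over matrices.\<close>

lemma least_squares_pythagoras:
  fixes P :: "'i \<Rightarrow> 'v::real_vector \<Rightarrow> 'w::real_inner"
  assumes lin: "\<And>t. linear (P t)"
    and orth: "\<And>d. (\<Sum>t\<in>I. (y t - P t b0) \<bullet> P t d) = 0"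
  shows "(\<Sum>t\<in>I. (norm (y t - P t b))\<^sup>2)
       = (\<Sum>t\<in>I. (norm (y t - P t b0))\<^sup>2) + (\<Sum>t\<in>I. (norm (P t b - P t b0))\<^sup>2)"
proof -
  have "(norm (y t - P t b))\<^sup>2 = (norm (y t - P t b0))\<^sup>2 + (norm (P t b - P t b0))\<^sup>2
          - 2 * ((y t - P t b0) \<bullet> P t (b - b0))" for t
    unfolding linear_diff[OF lin] power2_norm_eq_inner
    by (simp add: inner_diff_left inner_diff_right inner_commute)
  then show ?thesis
    by (simp add: sum.distrib sum_subtractf sum_distrib_left[symmetric] orth)
qed

text \<open>Only fitted values are compared, not parameters: the \<open>P t\<close> need not
  separate parameters. This suffices below, since a Gram matrix product sees a parameter only
  through its fitted values.\<close>

lemma least_squares_arg_min: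
  fixes P :: "'i \<Rightarrow> 'v::real_vector \<Rightarrow> 'w::real_inner"
  assumes lin: "\<And>t. linear (P t)"
    and orth: "\<And>d. (\<Sum>t\<in>I. (y t - P t b0) \<bullet> P t d) = 0"
    and "finite I" "t \<in> I"
  shows "P t (ARG_MIN (\<lambda>b. \<Sum>t\<in>I. (norm (y t - P t b))\<^sup>2) b. True) = P t b0"
proof -
  let ?f = "\<lambda>b. \<Sum>t\<in>I. (norm (y t - P t b))\<^sup>2"
  define b where "b = (ARG_MIN ?f b. True)"
  note pyth = least_squares_pythagoras[OF lin orth]
  \<comment> \<open>\<open>ARG_MIN\<close> is a choice operator, so a minimiser must be exhibited
    before anything is known about \<open>b\<close>.\<close>
  have "is_arg_min ?f (\<lambda>_. True) b0"
    unfolding is_arg_min_linorder by (subst pyth) (simp add: sum_nonneg)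
  then have "is_arg_min ?f (\<lambda>_. True) b"
    unfolding b_def arg_min_def by (rule someI)
  then have "?f b \<le> ?f b0"
    by (simp add: is_arg_min_linorder)
  with pyth[of b] have "(\<Sum>t\<in>I. (norm (P t b - P t b0))\<^sup>2) \<le> 0"
    by linarith
  then have "(\<Sum>t\<in>I. (norm (P t b - P t b0))\<^sup>2) = 0"
    by (simp add: sum_nonneg antisym)
  with assms(3,4) have "P t b = P t b0"
    by (simp add: sum_nonneg_eq_0_iff)
  then show ?thesis
    by (simp add: b_def)
qed

lemma matrix_inv_right: "invertible B \<Longrightarrow> B ** matrix_inv B = mat 1"
  and matrix_inv_left: "invertible B \<Longrightarrow> matrix_inv B ** B = mat 1"
  unfolding invertible_def matrix_inv_def by (metis (mono_tags, lifting) someI_ex)+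

lemma outer_prod_mult_vec: "outer_prod u v *v w = (v \<bullet> w) *\<^sub>R u"
  by (simp add: outer_prod_def matrix_vector_mult_def vec_eq_iff inner_vec_def
      sum_distrib_left sum_distrib_right mult_ac)

lemma mult_outer_prod: "B ** outer_prod u v = outer_prod (B *v u) v"
  by (simp add: outer_prod_def matrix_matrix_mult_def matrix_vector_mult_def vec_eq_iff
      sum_distrib_left sum_distrib_right mult_ac)

lemma transpose_outer_prod: "transpose (outer_prod u v) = outer_prod v u"
  by (simp add: outer_prod_def transpose_def vec_eq_iff mult.commute)

lemma outer_prod_diff_left: "outer_prod (u - v) w = outer_prod u w - outer_prod v w"
  by (simp add: outer_prod_def vec_eq_iff left_diff_distrib)

lemma outer_prod_diff_scaleR_right:
  "outer_prod u (v - c *\<^sub>R w) = outer_prod u v - c *\<^sub>R outer_prod u w"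
  by (simp add: outer_prod_def vec_eq_iff right_diff_distrib)

text \<open>The inner product on matrices is the Frobenius one; this rewrites orthogonality against
  all \<open>D *v v\<close> as a single matrix identity.\<close>

lemma inner_outer_prod: "outer_prod u v \<bullet> D = u \<bullet> (D *v v)"
  by (simp add: outer_prod_def matrix_vector_mult_def inner_vec_def sum_distrib_left mult_ac)

lemma matrix_mult_sum_right:
  fixes B :: "real ^ 'd ^ 'd"
  shows "B ** (\<Sum>t\<in>I. F t) = (\<Sum>t\<in>I. B ** F t)"
  by (induction I rule: infinite_finite_induct) (simp_all add: matrix_add_ldistrib)

lemma sum_matrix_mult_vec:
  fixes w :: "real ^ 'd"
  shows "(\<Sum>t\<in>I. F t) *v w = (\<Sum>t\<in>I. F t *v w)"
  by (induction I rule: infinite_finite_induct) (simp_all add: matrix_vector_mult_add_rdistrib)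

lemma transpose_sum:
  fixes F :: "'i \<Rightarrow> real ^ 'd ^ 'd"
  shows "transpose (\<Sum>t\<in>I. F t) = (\<Sum>t\<in>I. transpose (F t))"
  by (simp add: transpose_def vec_eq_iff)

lemma gram_matrix_mult_vec: "gram_matrix n x *v w = (\<Sum>t=1..n. (w \<bullet> x t) *\<^sub>R x t)"
  by (simp add: gram_matrix_def sum_matrix_mult_vec outer_prod_mult_vec inner_commute)

lemma mult_gram_matrix: "B ** gram_matrix n x = (\<Sum>t=1..n. outer_prod (B *v x t) (x t))"
  by (simp add: gram_matrix_def matrix_mult_sum_right mult_outer_prod)

lemma transpose_gram_matrix: "transpose (gram_matrix n x) = gram_matrix n x"
  by (simp add: gram_matrix_def transpose_sum transpose_outer_prod)

lemma theta_hat_normal_equation: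
  assumes inv: "invertible (gram_matrix n x)"
  shows "gram_matrix n x *v theta_hat n x r = (\<Sum>t=1..n. r t *\<^sub>R x t)"
proof -
  let ?G = "gram_matrix n x" and ?b = "\<Sum>t=1..n. r t *\<^sub>R x t"
  \<comment> \<open>The explicit solution of the normal equation, which is exactly the orthogonality
    that \<open>least_squares_arg_min\<close> asks for.\<close>
  define b0 where "b0 = matrix_inv ?G *v ?b"
  have b0: "?G *v b0 = ?b"
    by (simp add: b0_def matrix_vector_mul_assoc matrix_inv_right inv)
  have orth: "(\<Sum>t=1..n. (r t - b0 \<bullet> x t) \<bullet> (d \<bullet> x t)) = 0" for d
  proof -
    have "(\<Sum>t=1..n. (r t - b0 \<bullet> x t) \<bullet> (d \<bullet> x t)) = d \<bullet> (?b - ?G *v b0)"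
      by (simp add: gram_matrix_mult_vec inner_diff_right inner_sum_right
          sum_subtractf[symmetric] left_diff_distrib)
    then show ?thesis
      by (simp add: b0)
  qed
  have "theta_hat n x r \<bullet> x t = b0 \<bullet> x t" if "t \<in> {1..n}" for t
    using least_squares_arg_min[where P = "\<lambda>t b. b \<bullet> x t" and y = r and I = "{1..n}",
        OF bounded_linear.linear[OF bounded_linear_inner_left] orth _ that]
    by (simp add: theta_hat_def)
  \<comment> \<open>By \<open>gram_matrix_mult_vec\<close>, both sides depend only on the fitted
    values.\<close>
  then have "?G *v theta_hat n x r = ?G *v b0"
    by (simp add: gram_matrix_mult_vec)
  then show ?thesis
    by (simp add: b0)
qed

text \<open>Same scheme as for \<open>theta_hat\<close>, with the unknown now a matrix to the left
  of the Gram matrix.\<close>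

lemma A_hat_normal_equation:
  assumes inv: "invertible (gram_matrix n x)"
  shows "A_hat n x ** gram_matrix n x = (\<Sum>t=1..n. outer_prod (x (Suc t)) (x t))"
proof -
  let ?G = "gram_matrix n x" and ?C = "\<Sum>t=1..n. outer_prod (x (Suc t)) (x t)"
  define B0 where "B0 = ?C ** matrix_inv ?G"
  have B0: "B0 ** ?G = ?C"
    by (simp add: B0_def matrix_mul_assoc[symmetric] matrix_inv_left inv)
  have orth: "(\<Sum>t=1..n. (x (Suc t) - B0 *v x t) \<bullet> (D *v x t)) = 0" for D
  proof -
    have "(\<Sum>t=1..n. (x (Suc t) - B0 *v x t) \<bullet> (D *v x t)) = (?C - B0 ** ?G) \<bullet> D"
      unfolding mult_gram_matrix sum_subtractf[symmetric] outer_prod_diff_left[symmetric]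
        inner_sum_left inner_outer_prod ..
    then show ?thesis
      by (simp add: B0)
  qed
  have lin: "linear (\<lambda>B :: real ^ 'a ^ 'a. B *v x t)" for t
    by (intro linearI)
      (simp_all add: matrix_vector_mult_add_rdistrib scaleR_matrix_vector_assoc)
  have "A_hat n x *v x t = B0 *v x t" if "t \<in> {1..n}" for t
    using least_squares_arg_min[where P = "\<lambda>t B. B *v x t" and y = "\<lambda>t. x (Suc t)"
        and I = "{1..n}", OF lin orth _ that]
    by (simp add: A_hat_def)
  then have "A_hat n x ** ?G = B0 ** ?G"
    by (simp add: mult_gram_matrix)
  then show ?thesis
    by (simp add: B0)
qed

lemma lstd_matrix_factorization:
  assumes inv: "invertible (gram_matrix n x)"
  shows "lstd_matrix \<gamma> n x = gram_matrix n x ** (mat 1 - \<gamma> *\<^sub>R transpose (A_hat n x))"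
proof -
  \<comment> \<open>The Gram matrix is symmetric, so transposing the normal equation moves it to the
    left.\<close>
  have "gram_matrix n x ** transpose (A_hat n x) = transpose (A_hat n x ** gram_matrix n x)"
    by (simp add: matrix_transpose_mul transpose_gram_matrix)
  also have "\<dots> = (\<Sum>t=1..n. outer_prod (x t) (x (Suc t)))"
    unfolding A_hat_normal_equation[OF inv] by (simp add: transpose_sum transpose_outer_prod)
  finally have "lstd_matrix \<gamma> n x
      = gram_matrix n x - \<gamma> *\<^sub>R (gram_matrix n x ** transpose (A_hat n x))"
    by (simp add: lstd_matrix_def gram_matrix_def outer_prod_diff_scaleR_right sum_subtractf
        scaleR_sum_right)
  then show ?thesis
    by (simp add: matrix_eq matrix_vector_mul_assoc[symmetric] matrix_vector_mult_diff_rdistrib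
        matrix_vector_mult_diff_distrib scaleR_matrix_vector_assoc[symmetric]
        matrix_vector_mult_scaleR)
qed

theorem beta_LSTD_eq_beta_model_based:
  assumes G: "invertible (gram_matrix n x)" and L: "invertible (lstd_matrix \<gamma> n x)"
  shows "beta_LSTD \<gamma> n x r = beta_model_based \<gamma> n x r"
proof -
  define K where "K = mat 1 - \<gamma> *\<^sub>R transpose (A_hat n x)"
  have fact: "lstd_matrix \<gamma> n x = gram_matrix n x ** K"
    unfolding K_def by (rule lstd_matrix_factorization[OF G])
  \<comment> \<open>This exhibits a left inverse of \<open>K\<close>, which is enough for a square
    matrix.\<close>
  then have "matrix_inv (lstd_matrix \<gamma> n x) ** gram_matrix n x ** K = mat 1"
    using matrix_inv_left[OF L] by (simp add: matrix_mul_assoc)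
  then have K: "invertible K"
    using invertible_left_inverse by blast
  \<comment> \<open>Comparing images under the LSTD matrix avoids inverting a product.\<close>
  have "lstd_matrix \<gamma> n x *v beta_model_based \<gamma> n x r
      = gram_matrix n x *v (K ** matrix_inv K *v theta_hat n x r)"
    by (simp add: beta_model_based_def K_def[symmetric] fact matrix_vector_mul_assoc
        matrix_mul_assoc)
  also have "\<dots> = (\<Sum>t=1..n. r t *\<^sub>R x t)"
    by (simp add: matrix_inv_right K theta_hat_normal_equation[OF G])
  finally have "beta_LSTD \<gamma> n x r
      = matrix_inv (lstd_matrix \<gamma> n x) *v (lstd_matrix \<gamma> n x *v beta_model_based \<gamma> n x r)"
    by (simp add: beta_LSTD_def)
  then show ?thesis
    by (simp add: matrix_vector_mul_assoc matrix_inv_left L)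
qed

theorem theorem5p1:
  fixes M :: "'w measure"
    and A :: "real ^ 'd ^ 'd"
    and \<theta> :: "real ^ 'd"
    and \<sigma> \<gamma> :: real
    and \<epsilon> X :: "nat \<Rightarrow> 'w \<Rightarrow> real ^ 'd"
    and \<eta> R :: "nat \<Rightarrow> 'w \<Rightarrow> real"
    and n :: nat
    and \<omega> :: 'w
  assumes "linear_reward_system M A \<theta> \<sigma> \<epsilon> \<eta> X R"
    and "1 \<le> n"
    and "0 < \<gamma>" and "\<gamma> \<le> 1"
    and "\<omega> \<in> space M"
    and "invertible (gram_matrix n (\<lambda>t. X t \<omega>))"
    and "invertible (lstd_matrix \<gamma> n (\<lambda>t. X t \<omega>))"
  shows "beta_LSTD \<gamma> n (\<lambda>t. X t \<omega>) (\<lambda>t. R t \<omega>)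
       = beta_model_based \<gamma> n (\<lambda>t. X t \<omega>) (\<lambda>t. R t \<omega>)"
  \<comment> \<open>Both estimators are functions of the realised dataset, so the deterministic
    identity applies to the trajectory at \<open>\<omega>\<close>.\<close>
  using assms(6,7) by (rule beta_LSTD_eq_beta_model_based)

end
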